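(* Let $H\in(0,1/2)$, $T>0$, and let $g\in AC([0,T])$, $g(t)=\int_0^tg'(s)\,ds$, with $g'\in L_2([0,T])$. Suppose that $g_B$ minimizes $$\int_0^T\left((g_W'(t))^2+(h(t))^2\right)dt,\qquad g_W'=g'-g_B',\quad h=K_0^{H,*}g_B',$$ among all suitable expansions $g=g_W+g_B$. Then $g_B'$ satisfies $$C_1^{-2}t^{1/2-H}\left(I_{T^-}^{1/2-H}\left(\cdot^{2H-1}I_0^{1/2-H}(\cdot^{1/2-H}g_B')\right)\right)(t)+g_B'(t)=g'(t)$$ for (almost) all $t\in[0,T]$.
   Context: An expansion $g=g_W+g_B$ is called suitable if $g_W,g_B\in AC([0,T])$, $g_W(t)=\int_0^t g_W'(s)ds$, $g_B(t)=\int_0^t g_B'(s)ds$, and $g_W',g_B'\in L_2([0,T])$. Riemann–Liouville fractional integrals of order $\alpha>0$ on $[0,T]$: $(I_0^\alpha\varphi)(t)=\frac1{\Gamma(\alpha)}\int_0^t(t-z)^{\alpha-1}\varphi(z)dz$ and $(I_{T^-}^\alpha\varphi)(t)=\frac1{\Gamma(\alpha)}\int_t^T(z-t)^{\alpha-1}\varphi(z)dz$. The dot denotes the integration variable. $C_1=\left(\frac{2H\Gamma(H+1/2)\Gamma(3/2-H)}{\Gamma(2-2H)}\right)^{1/2}$ and $(K^{H,*}_0\varphi)(t)=C_1^{-1}t^{H-1/2}\left(I_0^{1/2-H}(\cdot^{1/2-H}\varphi)\right)(t)$, which maps $L_2([0,T])$ into itself. *)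

theory Defs
  imports "HOL-Analysis.Analysis"
begin

definition absolutely_continuous_on :: "real \<Rightarrow> real \<Rightarrow> (real \<Rightarrow> real) \<Rightarrow> bool" where
  "absolutely_continuous_on a b f \<longleftrightarrow>
    (\<forall>\<epsilon>>0. \<exists>\<delta>>0. \<forall>D::(real \<times> real) set.
      finite D \<and> (\<forall>(u, v)\<in>D. a \<le> u \<and> u < v \<and> v \<le> b) \<and>
      disjoint_family_on (\<lambda>(u, v). {u<..<v}) D \<and> (\<Sum>(u, v)\<in>D. v - u) < \<delta>
      \<longrightarrow> (\<Sum>(u, v)\<in>D. \<bar>f v - f u\<bar>) < \<epsilon>)"

definition square_integrable_on :: "real \<Rightarrow> real \<Rightarrow> (real \<Rightarrow> real) \<Rightarrow> bool" where
  "square_integrable_on a b f \<longleftrightarrow>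
    f \<in> borel_measurable (lebesgue_on {a..b}) \<and> integrable (lebesgue_on {a..b}) (\<lambda>t. (f t)\<^sup>2)"

text \<open>
  An absolutely continuous function is differentiable almost everywhere only. Where the derivative
  does not exist \<open>deriv\<close> has an unspecified value, and at the end points of the
  interval it depends on values outside it; both concern null sets, which none of the
  notions below can detect.
\<close>

definition suitable_summand :: "real \<Rightarrow> (real \<Rightarrow> real) \<Rightarrow> bool" where
  "suitable_summand T f \<longleftrightarrow>
    absolutely_continuous_on 0 T f \<and>
    (\<forall>t\<in>{0..T}. f t = (LINT s:{0..t}|lebesgue. deriv f s)) \<and>
    square_integrable_on 0 T (deriv f)"

definition suitable_expansion ::
  "real \<Rightarrow> (real \<Rightarrow> real) \<Rightarrow> (real \<Rightarrow> real) \<Rightarrow> (real \<Rightarrow> real) \<Rightarrow> bool" where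
  "suitable_expansion T g g_W g_B \<longleftrightarrow>
    (\<forall>t\<in>{0..T}. g t = g_W t + g_B t) \<and> suitable_summand T g_W \<and> suitable_summand T g_B"

definition RL_left :: "real \<Rightarrow> (real \<Rightarrow> real) \<Rightarrow> real \<Rightarrow> real" where
  "RL_left \<alpha> \<phi> t = 1 / Gamma \<alpha> * (LINT z:{0..t}|lebesgue. (t - z) powr (\<alpha> - 1) * \<phi> z)"

definition RL_right :: "real \<Rightarrow> real \<Rightarrow> (real \<Rightarrow> real) \<Rightarrow> real \<Rightarrow> real" where
  "RL_right T \<alpha> \<phi> t = 1 / Gamma \<alpha> * (LINT z:{t..T}|lebesgue. (z - t) powr (\<alpha> - 1) * \<phi> z)"

definition C1 :: "real \<Rightarrow> real" where
  "C1 H = sqrt (2 * H * Gamma (H + 1/2) * Gamma (3/2 - H) / Gamma (2 - 2 * H))"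

definition K_star :: "real \<Rightarrow> (real \<Rightarrow> real) \<Rightarrow> real \<Rightarrow> real" where
  "K_star H \<phi> t =
    inverse (C1 H) * t powr (H - 1/2) * RL_left (1/2 - H) (\<lambda>z. z powr (1/2 - H) * \<phi> z) t"

definition expansion_cost :: "real \<Rightarrow> real \<Rightarrow> (real \<Rightarrow> real) \<Rightarrow> (real \<Rightarrow> real) \<Rightarrow> real" where
  "expansion_cost H T g_W g_B =
    (LINT t:{0..T}|lebesgue. (deriv g_W t)\<^sup>2 + (K_star H (deriv g_B) t)\<^sup>2)"

end

theory Submission
  imports Defs
begin

text \<open>
  Put \<open>\<alpha> = 1/2 - H\<close>. Up to a constant, \<open>K_star\<close> is the integral operator with kernel
  \<open>k(t, z) = t powr - \<alpha> * (t - z) powr (\<alpha> - 1) * z powr \<alpha>\<close> on \<open>0 \<le> z \<le> t\<close>. As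
  \<open>k(t, z) \<le> (t - z) powr (\<alpha> - 1)\<close>, its row and column integrals are uniformly bounded, so by the
  Schur test the operator is bounded on square-integrable functions, and by Fubini its adjoint is
  integration against the transposed kernel, i.e. a weighted right-sided fractional integral.

  Moving \<open>\<epsilon> * min t a\<close> from \<open>g_W\<close> to \<open>g_B\<close> changes the derivatives by \<open>\<epsilon>\<close> times the indicator
  of \<open>{0..a}\<close>, at almost every point by Lebesgue's differentiation theorem. The cost is a quadratic
  polynomial in \<open>\<epsilon>\<close> with minimum at \<open>0\<close>, so its linear coefficient vanishes: the adjoint of
  \<open>K_star\<close> applied to \<open>K_star H (deriv g_B)\<close>, minus \<open>deriv g_W\<close>, has integral zero over every
  \<open>{0..a}\<close>, and therefore vanishes almost everywhere.
\<close>

section \<open>Differentiation of indefinite integrals\<close>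

text \<open>The Lebesgue differentiation theorem for boxes with lower corner \<open>x\<close>. In
  dimension one such a box is \<open>{x..x + h}\<close>, so only right-hand averages are
  covered.\<close>

lemma AE_tendsto_right_average:
  fixes f :: "real \<Rightarrow> real"
  assumes "\<And>a b. f integrable_on {a..b}"
  shows "AE x in lebesgue. ((\<lambda>h. integral {x..x + h} f / h) \<longlongrightarrow> f x) (at_right 0)"
proof -
  obtain N where N: "negligible N"
    "\<And>x e. \<lbrakk>x \<notin> N; 0 < e\<rbrakk> \<Longrightarrow> \<exists>d>0. \<forall>h. 0 < h \<and> h < d \<longrightarrow>
        norm (integral (cbox x (x + h *\<^sub>R One)) f /\<^sub>R h ^ DIM(real) - f x) < e"
    using integrable_ccontinuous_explicit[of f] assms by auto
  show ?thesis
  proof (rule AE_I')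
    show "N \<in> null_sets lebesgue"
      using N(1) by (simp add: negligible_iff_null_sets)
    show "{x \<in> space lebesgue. \<not> ((\<lambda>h. integral {x..x + h} f / h) \<longlongrightarrow> f x) (at_right 0)} \<subseteq> N"
    proof clarify
      fix x
      assume *: "\<not> ((\<lambda>h. integral {x..x + h} f / h) \<longlongrightarrow> f x) (at_right 0)"
      show "x \<in> N"
      proof (rule ccontr)
        assume "x \<notin> N"
        have "((\<lambda>h. integral {x..x + h} f / h) \<longlongrightarrow> f x) (at_right 0)"
        proof (rule tendstoI)
          fix e :: real
          assume "0 < e"
          from N(2)[OF \<open>x \<notin> N\<close> this] show "\<forall>\<^sub>F h in at_right 0. dist (integral {x..x + h} f / h) (f x) < e"
            unfolding eventually_at_right_field
            by (auto simp: dist_real_def divide_inverse mult.commute)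
        qed
        with * show False ..
      qed
    qed
  qed
qed

text \<open>Right-hand difference quotients are right averages; left-hand ones become right averages
  of the reflected function. Where both converge to the same value, the two-sided derivative exists.
  The end points form a null set and are discarded, so that the argument runs in the open
  interval.\<close>

lemma AE_has_real_derivative_indefinite_integral:
  fixes f :: "real \<Rightarrow> real"
  assumes f: "set_integrable lebesgue {a..b} f"
  shows "AE x in lebesgue_on {a..b}. ((\<lambda>t. LINT s:{a..t}|lebesgue. f s) has_real_derivative f x) (at x)"
proof -
  \<comment> \<open>Extension by zero makes the function integrable over every compact interval, as
    the averaging lemma demands.\<close>
  define F where "F = (\<lambda>x. if x \<in> {a..b} then f x else 0)"
  have F_UNIV: "F integrable_on UNIV"
    unfolding F_def integrable_restrict_UNIV
    using f by (rule set_lebesgue_integral_eq_integral)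
  have F: "F integrable_on {u..v}" for u v
    using F_UNIV integrable_on_subinterval by blast
  have F': "(\<lambda>x. F (- x)) integrable_on {u..v}" for u v
    using F[of "-v" "-u"]
    by (subst (asm) Henstock_Kurzweil_Integration.integrable_reflect_real[symmetric]) simp
  have right: "AE x in lebesgue. ((\<lambda>h. integral {x..x + h} F / h) \<longlongrightarrow> F x) (at_right 0)"
    by (rule AE_tendsto_right_average[OF F])
  have "AE x in lebesgue. ((\<lambda>h. integral {x..x + h} (\<lambda>x. F (- x)) / h) \<longlongrightarrow> F (- x)) (at_right 0)"
    by (rule AE_tendsto_right_average[OF F'])
  moreover define N where "N =
    {x. \<not> ((\<lambda>h. integral {x..x + h} (\<lambda>x. F (- x)) / h) \<longlongrightarrow> F (- x)) (at_right 0)}"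
  ultimately have N: "N \<in> null_sets lebesgue"
    by (simp add: completion.AE_iff_null_sets)
  \<comment> \<open>The exceptional set of the reflected function has to be reflected back; a
    differentiable map sends negligible sets to negligible sets.\<close>
  have "negligible (uminus ` N)"
    using N 
    by (intro negligible_differentiable_image_negligible) (auto simp: negligible_iff_null_sets)
  then have "AE x in lebesgue. x \<notin> uminus ` N"
    by (intro AE_not_in) (simp add: negligible_iff_null_sets)
  then have left: "AE x in lebesgue. ((\<lambda>h. integral {x - h..x} F / h) \<longlongrightarrow> F x) (at_right 0)"
  proof (rule AE_mp, intro AE_I2 impI)
    fix x
    assume "x \<notin> uminus ` N"
    then have "- x \<notin> N" by force
    then have "((\<lambda>h. integral {- x..- x + h} (\<lambda>x. F (- x)) / h) \<longlongrightarrow> F x) (at_right 0)"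
      by (simp add: N_def)
    moreover have "integral {- x..- x + h} (\<lambda>x. F (- x)) = integral {x - h..x} F" for h
      using Henstock_Kurzweil_Integration.integral_reflect_real[of x "x - h" F] by simp
    ultimately show "((\<lambda>h. integral {x - h..x} F / h) \<longlongrightarrow> F x) (at_right 0)"
      by simp
  qed
  have ends: "AE x in lebesgue. x \<noteq> a \<and> x \<noteq> b"
    using AE_not_in[of "{a, b}" lebesgue] by (simp add: null_sets_completionI finite_imp_null_set_lborel)
  have "AE x in lebesgue. x \<in> {a..b} \<longrightarrow>
      ((\<lambda>t. LINT s:{a..t}|lebesgue. f s) has_real_derivative f x) (at x)"
    using right left ends
  proof (eventually_elim, intro impI)
    fix x
    assume R: "((\<lambda>h. integral {x..x + h} F / h) \<longlongrightarrow> F x) (at_right 0)"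
      and L: "((\<lambda>h. integral {x - h..x} F / h) \<longlongrightarrow> F x) (at_right 0)"
      and ne: "x \<noteq> a \<and> x \<noteq> b" and "x \<in> {a..b}"
    then have x: "a < x" "x < b" by auto
    have R': "((\<lambda>y. (integral {a..x + y} F - integral {a..x} F) / y) \<longlongrightarrow> F x) (at_right 0)"
    proof (rule Lim_transform_eventually[OF R])
      have "\<forall>\<^sub>F h :: real in at_right 0. 0 < h"
        by (simp add: eventually_at_right_less)
      then show "\<forall>\<^sub>F h in at_right 0. integral {x..x + h} F / h = (integral {a..x + h} F - integral {a..x} F) / h"
      proof eventually_elim
        case (elim h)
        then show ?case
          using Henstock_Kurzweil_Integration.integral_combine[of a x "x + h" F] F x by simp
      qed
    qed
    \<comment> \<open>The substitution \<open>y = - h\<close> with \<open>0 < h < x - a\<close>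
      turns the left quotient into the average over \<open>{x - h..x}\<close>, and
      \<open>x - h\<close> stays to the right of \<open>a\<close>.\<close>
    have L': "((\<lambda>y. (integral {a..x + y} F - integral {a..x} F) / y) \<longlongrightarrow> F x) (at_left 0)"
      unfolding filterlim_at_left_to_right
    proof (simp, rule Lim_transform_eventually[OF L])
      have "\<forall>\<^sub>F h in at_right 0. h \<in> {0<..<x - a}"
        using x by (intro eventually_at_right_real) simp
      then show "\<forall>\<^sub>F h in at_right 0. integral {x - h..x} F / h = - ((integral {a..x - h} F - integral {a..x} F) / h)"
      proof eventually_elim
        case (elim h)
        then show ?case
          using Henstock_Kurzweil_Integration.integral_combine[of a "x - h" x F] F x
          by (simp add: field_simps)
      qed
    qed
    have "((\<lambda>y. (integral {a..x + y} F - integral {a..x} F) / y) \<longlongrightarrow> F x) (at 0)"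
      using L' R' by (simp add: filterlim_at_split)
    then have "((\<lambda>t. integral {a..t} F) has_real_derivative F x) (at x)"
      by (simp add: DERIV_def)
    then have "((\<lambda>t. integral {a..t} F) has_real_derivative f x) (at x)"
      using x by (simp add: F_def)
    \<comment> \<open>The derivative was computed for the gauge integral of \<open>F\<close>; close
      to \<open>x\<close> it coincides with the Lebesgue integral of \<open>f\<close>.\<close>
    moreover have "\<forall>\<^sub>F t in nhds x. integral {a..t} F = (LINT s:{a..t}|lebesgue. f s)"
    proof -
      have "\<forall>\<^sub>F t in nhds x. t \<in> {a<..<b}"
        using x by (intro eventually_nhds_in_open) auto
      then show ?thesis
      proof eventually_elim
        case (elim t)
        have "integral {a..t} F = integral {a..t} f"
          using elim by (intro integral_cong) (auto simp: F_def)
        also have "\<dots> = (LINT s:{a..t}|lebesgue. f s)"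
          using elim by (intro set_lebesgue_integral_eq_integral(2)[symmetric] set_integrable_subset[OF f]) auto
        finally show ?case .
      qed
    qed
    ultimately show "((\<lambda>t. LINT s:{a..t}|lebesgue. f s) has_real_derivative f x) (at x)"
      by (subst (asm) DERIV_cong_ev[OF refl _ refl]) auto
  qed
  then show ?thesis
    by (subst AE_restrict_space_iff) auto
qed

text \<open>At almost every point \<open>f\<close> is the derivative of its indefinite integral,
  which is constantly zero near interior points; derivatives are unique.\<close>

lemma AE_zero_if_indefinite_integral_zero:
  fixes f :: "real \<Rightarrow> real"
  assumes f: "set_integrable lebesgue {a..b} f"
    and zero: "\<And>t. t \<in> {a..b} \<Longrightarrow> (LINT s:{a..t}|lebesgue. f s) = 0"
  shows "AE x in lebesgue_on {a..b}. f x = 0"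
proof -
  have "AE x in lebesgue. x \<noteq> a \<and> x \<noteq> b"
    using AE_not_in[of "{a, b}" lebesgue] by (simp add: null_sets_completionI finite_imp_null_set_lborel)
  moreover have "AE x in lebesgue. x \<in> {a..b} \<longrightarrow>
      ((\<lambda>t. LINT s:{a..t}|lebesgue. f s) has_real_derivative f x) (at x)"
    using AE_has_real_derivative_indefinite_integral[OF f] by (simp add: AE_restrict_space_iff)
  ultimately have "AE x in lebesgue. x \<in> {a..b} \<longrightarrow> f x = 0"
  proof (eventually_elim, intro impI)
    fix x
    assume "x \<noteq> a \<and> x \<noteq> b" and "x \<in> {a..b}" and
      "x \<in> {a..b} \<longrightarrow> ((\<lambda>t. LINT s:{a..t}|lebesgue. f s) has_real_derivative f x) (at x)"
    then have x: "a < x" "x < b"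
      and D: "((\<lambda>t. LINT s:{a..t}|lebesgue. f s) has_real_derivative f x) (at x)" by auto
    have "\<forall>\<^sub>F t in nhds x. t \<in> {a<..<b}"
      using x by (intro eventually_nhds_in_open) auto
    then have "\<forall>\<^sub>F t in nhds x. (LINT s:{a..t}|lebesgue. f s) = 0"
      by eventually_elim (auto intro: zero)
    with D have "((\<lambda>t. 0) has_real_derivative f x) (at x)"
      by (subst (asm) DERIV_cong_ev[OF refl _ refl]) auto
    then show "f x = 0"
      using DERIV_unique DERIV_const by blast
  qed
  then show ?thesis
    by (subst AE_restrict_space_iff) auto
qed

section \<open>The Schur test\<close>

text \<open>The factor 1/2 of the arithmetic-geometric mean inequality is given away, since the
  bound serves only to establish integrability.\<close>

lemma abs_mult_le_sum_squares: "\<bar>a * b\<bar> \<le> a\<^sup>2 + b\<^sup>2" for a b :: real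
proof -
  have "2 * \<bar>a * b\<bar> \<le> a\<^sup>2 + b\<^sup>2"
    using sum_squares_bound[of "\<bar>a\<bar>" "\<bar>b\<bar>"] by (simp add: abs_mult)
  then show ?thesis
    using abs_ge_zero[of "a * b"] by linarith
qed

text \<open>The hypotheses of the Schur test with constant weights. Finiteness of the measure makes
  constants square-integrable, so they can serve as test functions.\<close>

locale schur_kernel = finite_measure M for M :: "'a measure" +
  fixes k :: "'a \<Rightarrow> 'a \<Rightarrow> real" and A :: real
  assumes kernel_measurable [measurable]: "case_prod k \<in> borel_measurable (M \<Otimes>\<^sub>M M)"
    and kernel_nonneg: "0 \<le> k x y"
    and row: "x \<in> space M \<Longrightarrow> (\<integral>\<^sup>+ y. ennreal (k x y) \<partial>M) \<le> ennreal A"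
    and col: "y \<in> space M \<Longrightarrow> (\<integral>\<^sup>+ x. ennreal (k x y) \<partial>M) \<le> ennreal A"
begin

sublocale pair: pair_sigma_finite M M ..

definition kernel_op :: "('a \<Rightarrow> real) \<Rightarrow> 'a \<Rightarrow> real" where
  "kernel_op f x = (\<integral>y. k x y * f y \<partial>M)"

definition kernel_adj :: "('a \<Rightarrow> real) \<Rightarrow> 'a \<Rightarrow> real" where
  "kernel_adj u y = (\<integral>x. k x y * u x \<partial>M)"

text \<open>Tonelli brings the integral over \<open>x\<close> inside, where the column bound applies
  and leaves \<open>A\<close> times the integral of the square of \<open>f\<close>.\<close>

lemma nn_integral_weighted_snd:
  assumes [measurable]: "f \<in> borel_measurable M" and "integrable M (\<lambda>x. (f x)\<^sup>2)"
  shows "(\<integral>\<^sup>+ x. \<integral>\<^sup>+ y. ennreal (k x y * (f y)\<^sup>2) \<partial>M \<partial>M) < \<infinity>"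
proof -
  have "(\<integral>\<^sup>+ x. \<integral>\<^sup>+ y. ennreal (k x y * (f y)\<^sup>2) \<partial>M \<partial>M) = (\<integral>\<^sup>+ y. \<integral>\<^sup>+ x. ennreal (k x y * (f y)\<^sup>2) \<partial>M \<partial>M)"
    by (rule pair.Fubini'[symmetric]) measurable
  also have "\<dots> = (\<integral>\<^sup>+ y. (\<integral>\<^sup>+ x. ennreal (k x y) \<partial>M) * ennreal ((f y)\<^sup>2) \<partial>M)"
    by (intro nn_integral_cong) (simp add: ennreal_mult' kernel_nonneg nn_integral_multc)
  also have "\<dots> \<le> (\<integral>\<^sup>+ y. ennreal A * ennreal ((f y)\<^sup>2) \<partial>M)"
    by (intro nn_integral_mono mult_right_mono col) auto
  also have "\<dots> = ennreal A * (\<integral>\<^sup>+ y. ennreal ((f y)\<^sup>2) \<partial>M)"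
    by (simp add: nn_integral_cmult)
  also have "\<dots> < \<infinity>"
    using assms(2) by (simp add: integrable_iff_bounded ennreal_mult_less_top)
  finally show ?thesis .
qed

text \<open>Here the weight depends on the outer variable, so the row bound applies without
  interchanging the integrals.\<close>

lemma nn_integral_weighted_fst:
  assumes [measurable]: "u \<in> borel_measurable M" and "integrable M (\<lambda>x. (u x)\<^sup>2)"
  shows "(\<integral>\<^sup>+ x. \<integral>\<^sup>+ y. ennreal (k x y * (u x)\<^sup>2) \<partial>M \<partial>M) < \<infinity>"
proof -
  have "(\<integral>\<^sup>+ x. \<integral>\<^sup>+ y. ennreal (k x y * (u x)\<^sup>2) \<partial>M \<partial>M) = (\<integral>\<^sup>+ x. (\<integral>\<^sup>+ y. ennreal (k x y) \<partial>M) * ennreal ((u x)\<^sup>2) \<partial>M)"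
    by (intro nn_integral_cong) (simp add: ennreal_mult' kernel_nonneg nn_integral_multc)
  also have "\<dots> \<le> (\<integral>\<^sup>+ y. ennreal A * ennreal ((u y)\<^sup>2) \<partial>M)"
    by (intro nn_integral_mono mult_right_mono row) auto
  also have "\<dots> = ennreal A * (\<integral>\<^sup>+ y. ennreal ((u y)\<^sup>2) \<partial>M)"
    by (simp add: nn_integral_cmult)
  also have "\<dots> < \<infinity>"
    using assms(2) by (simp add: integrable_iff_bounded ennreal_mult_less_top)
  finally show ?thesis .
qed

text \<open>The product of \<open>f y\<close> and \<open>u x\<close> is dominated by the sum of
  their squares, which reduces the claim to the two weighted bounds. This absolute integrability is
  what licenses Fubini for the adjoint.\<close>

lemma integrable_kernel_product:
  assumes [measurable]: "f \<in> borel_measurable M" "u \<in> borel_measurable M"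
    and f: "integrable M (\<lambda>x. (f x)\<^sup>2)" and u: "integrable M (\<lambda>x. (u x)\<^sup>2)"
  shows "integrable (M \<Otimes>\<^sub>M M) (\<lambda>(x, y). k x y * f y * u x)"
  unfolding integrable_iff_bounded
proof
  show "(\<lambda>(x, y). k x y * f y * u x) \<in> borel_measurable (M \<Otimes>\<^sub>M M)"
    by measurable
  have "(\<integral>\<^sup>+ p. ennreal (norm (case p of (x, y) \<Rightarrow> k x y * f y * u x)) \<partial>(M \<Otimes>\<^sub>M M))
      = (\<integral>\<^sup>+ x. \<integral>\<^sup>+ y. ennreal (norm (k x y * f y * u x)) \<partial>M \<partial>M)"
    using nn_integral_fst[of "\<lambda>p. ennreal (norm (case p of (x, y) \<Rightarrow> k x y * f y * u x))" M]
    by simp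
  also have "\<dots> \<le> (\<integral>\<^sup>+ x. \<integral>\<^sup>+ y. ennreal (k x y * (f y)\<^sup>2) + ennreal (k x y * (u x)\<^sup>2) \<partial>M \<partial>M)"
  proof (intro nn_integral_mono)
    fix x y
    have "\<bar>f y * u x\<bar> \<le> (f y)\<^sup>2 + (u x)\<^sup>2"
      by (rule abs_mult_le_sum_squares)
    then have "k x y * \<bar>f y * u x\<bar> \<le> k x y * ((f y)\<^sup>2 + (u x)\<^sup>2)"
      by (intro mult_left_mono kernel_nonneg)
    then show "ennreal (norm (k x y * f y * u x)) \<le> ennreal (k x y * (f y)\<^sup>2) + ennreal (k x y * (u x)\<^sup>2)"
      by (simp add: kernel_nonneg abs_mult algebra_simps ennreal_leI flip: ennreal_plus)
  qed
  also have "\<dots> = (\<integral>\<^sup>+ x. (\<integral>\<^sup>+ y. ennreal (k x y * (f y)\<^sup>2) \<partial>M) + (\<integral>\<^sup>+ y. ennreal (k x y * (u x)\<^sup>2) \<partial>M) \<partial>M)"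
    by (intro nn_integral_cong nn_integral_add) measurable
  also have "\<dots> = (\<integral>\<^sup>+ x. \<integral>\<^sup>+ y. ennreal (k x y * (f y)\<^sup>2) \<partial>M \<partial>M) + (\<integral>\<^sup>+ x. \<integral>\<^sup>+ y. ennreal (k x y * (u x)\<^sup>2) \<partial>M \<partial>M)"
    by (intro nn_integral_add) measurable
  also have "\<dots> < \<infinity>"
    using nn_integral_weighted_snd[of f] nn_integral_weighted_fst[of u] f u by simp
  finally show "(\<integral>\<^sup>+ p. ennreal (norm (case p of (x, y) \<Rightarrow> k x y * f y * u x)) \<partial>(M \<Otimes>\<^sub>M M)) < \<infinity>" .
qed

text \<open>Almost every section of an integrable function on the product is integrable; the test
  function in \<open>x\<close> is the constant 1.\<close>

lemma AE_integrable_kernel_mult: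
  assumes [measurable]: "f \<in> borel_measurable M" and f: "integrable M (\<lambda>x. (f x)\<^sup>2)"
  shows "AE x in M. integrable M (\<lambda>y. k x y * f y)"
  using pair.AE_integrable_fst[OF integrable_kernel_product[OF assms(1) _ f, of "\<lambda>_. 1"]] by simp

lemma borel_measurable_op [measurable]:
  assumes [measurable]: "f \<in> borel_measurable M"
  shows "kernel_op f \<in> borel_measurable M"
  unfolding kernel_op_def[abs_def] by measurable

text \<open>Splitting the kernel as \<open>sqrt (k x y) * sqrt (k x y)\<close> and applying
  Cauchy-Schwarz bounds the square of \<open>kernel_op f x\<close> by the row integral times the
  integral of \<open>k x y\<close> against the square of \<open>f\<close>. Integrating over
  \<open>x\<close> leaves a weighted integral already known to be finite.\<close>

lemma integrable_op_power2:
  assumes [measurable]: "f \<in> borel_measurable M" and f: "integrable M (\<lambda>x. (f x)\<^sup>2)"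
  shows "integrable M (\<lambda>x. (kernel_op f x)\<^sup>2)"
  unfolding integrable_iff_bounded
proof
  show "(\<lambda>x. (kernel_op f x)\<^sup>2) \<in> borel_measurable M"
    by measurable
  have *: "ennreal ((kernel_op f x)\<^sup>2) \<le> ennreal A * (\<integral>\<^sup>+ y. ennreal (k x y * (f y)\<^sup>2) \<partial>M)"
    if x: "x \<in> space M" for x
  proof -
    have "ennreal \<bar>kernel_op f x\<bar> \<le> (\<integral>\<^sup>+ y. ennreal \<bar>k x y * f y\<bar> \<partial>M)"
      \<comment> \<open>Where the section is not integrable, the Bochner integral takes its default
        value 0 and the bound is trivial.\<close>
      using integral_norm_bound_ennreal[of M "\<lambda>y. k x y * f y"] not_integrable_integral_eq[of M "\<lambda>y. k x y * f y"]
      by (cases "integrable M (\<lambda>y. k x y * f y)") (auto simp: kernel_op_def)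
    also have "\<dots> = (\<integral>\<^sup>+ y. ennreal (sqrt (k x y)) * ennreal (sqrt (k x y) * \<bar>f y\<bar>) \<partial>M)"
      by (intro nn_integral_cong)
        (simp add: kernel_nonneg abs_mult flip: ennreal_mult mult.assoc)
    finally have "(ennreal \<bar>kernel_op f x\<bar>)\<^sup>2 \<le> (\<integral>\<^sup>+ y. ennreal (sqrt (k x y)) * ennreal (sqrt (k x y) * \<bar>f y\<bar>) \<partial>M)\<^sup>2"
      by (rule power_mono) simp
    also have "\<dots> \<le> (\<integral>\<^sup>+ y. (ennreal (sqrt (k x y)))\<^sup>2 \<partial>M) * (\<integral>\<^sup>+ y. (ennreal (sqrt (k x y) * \<bar>f y\<bar>))\<^sup>2 \<partial>M)"
      using x by (intro Cauchy_Schwarz_nn_integral) measurable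
    also have "\<dots> = (\<integral>\<^sup>+ y. ennreal (k x y) \<partial>M) * (\<integral>\<^sup>+ y. ennreal (k x y * (f y)\<^sup>2) \<partial>M)"
      by (simp add: kernel_nonneg ennreal_power power_mult_distrib)
    also have "\<dots> \<le> ennreal A * (\<integral>\<^sup>+ y. ennreal (k x y * (f y)\<^sup>2) \<partial>M)"
      by (intro mult_right_mono row x) auto
    finally show ?thesis
      by (simp add: ennreal_power)
  qed
  have "(\<integral>\<^sup>+ x. ennreal (norm ((kernel_op f x)\<^sup>2)) \<partial>M) \<le> (\<integral>\<^sup>+ x. ennreal A * (\<integral>\<^sup>+ y. ennreal (k x y * (f y)\<^sup>2) \<partial>M) \<partial>M)"
    by (intro nn_integral_mono) (simp add: *)
  also have "\<dots> = ennreal A * (\<integral>\<^sup>+ x. \<integral>\<^sup>+ y. ennreal (k x y * (f y)\<^sup>2) \<partial>M \<partial>M)"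
    by (intro nn_integral_cmult) measurable
  also have "\<dots> < \<infinity>"
    using nn_integral_weighted_snd[OF assms] by (simp add: ennreal_mult_less_top)
  finally show "(\<integral>\<^sup>+ x. ennreal (norm ((kernel_op f x)\<^sup>2)) \<partial>M) < \<infinity>" .
qed

text \<open>Both claims come from Fubini for the integrable function
  \<open>k x y * f y * u x\<close>: integrating out one variable in either order gives the pairing,
  and the partial integral over \<open>x\<close> is itself integrable.\<close>

lemma
  assumes [measurable]: "f \<in> borel_measurable M" "u \<in> borel_measurable M"
    and f: "integrable M (\<lambda>x. (f x)\<^sup>2)" and u: "integrable M (\<lambda>x. (u x)\<^sup>2)"
  shows integral_op_adj: "(\<integral>x. kernel_op f x * u x \<partial>M) = (\<integral>y. f y * kernel_adj u y \<partial>M)"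
    and integrable_mult_adj: "integrable M (\<lambda>y. f y * kernel_adj u y)"
proof -
  note int = integrable_kernel_product[OF assms]
  have "(\<integral>x. kernel_op f x * u x \<partial>M) = (\<integral>x. \<integral>y. k x y * f y * u x \<partial>M \<partial>M)"
    by (simp add: kernel_op_def)
  also have "\<dots> = (\<integral>y. \<integral>x. k x y * f y * u x \<partial>M \<partial>M)"
    by (rule pair.Fubini_integral[OF int, symmetric])
  also have eq: "(\<lambda>y. \<integral>x. k x y * f y * u x \<partial>M) = (\<lambda>y. f y * kernel_adj u y)"
    unfolding kernel_adj_def integral_mult_right_zero[symmetric] by (simp add: mult_ac)
  finally show "(\<integral>x. kernel_op f x * u x \<partial>M) = (\<integral>y. f y * kernel_adj u y \<partial>M)" .
  show "integrable M (\<lambda>y. f y * kernel_adj u y)"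
    using pair.integrable_snd[OF int] by (simp add: eq)
qed

text \<open>An integral ignores null sets, so the values agree at every point of the space even
  though the arguments agree only almost everywhere.\<close>

lemma kernel_op_cong_AE:
  assumes eq: "AE y in M. f y = g y"
    and [measurable]: "f \<in> borel_measurable M" "g \<in> borel_measurable M"
    and x: "x \<in> space M"
  shows "kernel_op f x = kernel_op g x"
  unfolding kernel_op_def
proof (rule integral_cong_AE)
  show "(\<lambda>y. k x y * f y) \<in> borel_measurable M" "(\<lambda>y. k x y * g y) \<in> borel_measurable M"
    using x by measurable
  show "AE y in M. k x y * f y = k x y * g y"
    using eq by eventually_elim simp
qed

text \<open>Linearity of the Bochner integral requires both sections to be integrable, which is
  guaranteed at almost every \<open>x\<close> only.\<close>

lemma AE_kernel_op_add_cmult: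
  assumes "f \<in> borel_measurable M" "integrable M (\<lambda>x. (f x)\<^sup>2)"
    and "g \<in> borel_measurable M" "integrable M (\<lambda>x. (g x)\<^sup>2)"
  shows "AE x in M. kernel_op (\<lambda>y. f y + e * g y) x = kernel_op f x + e * kernel_op g x"
  using AE_integrable_kernel_mult[OF assms(1,2)] AE_integrable_kernel_mult[OF assms(3,4)]
proof eventually_elim
  case (elim x)
  have "kernel_op (\<lambda>y. f y + e * g y) x = (\<integral>y. k x y * f y + e * (k x y * g y) \<partial>M)"
    by (simp add: kernel_op_def algebra_simps)
  with elim show ?case
    by (simp add: kernel_op_def)
qed

end

section \<open>Perturbing a suitable summand\<close>

lemma absolutely_continuous_on_add:
  assumes f: "absolutely_continuous_on a b f" and g: "absolutely_continuous_on a b g"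
  shows "absolutely_continuous_on a b (\<lambda>t. f t + g t)"
  unfolding absolutely_continuous_on_def
proof (intro allI impI)
  fix e :: real
  assume "0 < e"
  then have "0 < e / 2" by simp
  obtain d where d: "0 < d" "\<And>D. \<lbrakk>finite D; \<forall>(u, v)\<in>D. a \<le> u \<and> u < v \<and> v \<le> b;
      disjoint_family_on (\<lambda>(u, v). {u<..<v}) D; (\<Sum>(u, v)\<in>D. v - u) < d\<rbrakk> \<Longrightarrow> (\<Sum>(u, v)\<in>D. \<bar>f v - f u\<bar>) < e / 2"
    using f \<open>0 < e / 2\<close> unfolding absolutely_continuous_on_def by meson
  obtain d' where d': "0 < d'" "\<And>D. \<lbrakk>finite D; \<forall>(u, v)\<in>D. a \<le> u \<and> u < v \<and> v \<le> b;
      disjoint_family_on (\<lambda>(u, v). {u<..<v}) D; (\<Sum>(u, v)\<in>D. v - u) < d'\<rbrakk> \<Longrightarrow> (\<Sum>(u, v)\<in>D. \<bar>g v - g u\<bar>) < e / 2"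
    using g \<open>0 < e / 2\<close> unfolding absolutely_continuous_on_def by meson
  show "\<exists>\<delta>>0. \<forall>D. finite D \<and> (\<forall>(u, v)\<in>D. a \<le> u \<and> u < v \<and> v \<le> b) \<and>
      disjoint_family_on (\<lambda>(u, v). {u<..<v}) D \<and> (\<Sum>(u, v)\<in>D. v - u) < \<delta> \<longrightarrow>
      (\<Sum>(u, v)\<in>D. \<bar>f v + g v - (f u + g u)\<bar>) < e"
  proof (intro exI[of _ "min d d'"] conjI allI impI)
    fix D :: "(real \<times> real) set"
    assume "finite D \<and> (\<forall>(u, v)\<in>D. a \<le> u \<and> u < v \<and> v \<le> b) \<and>
      disjoint_family_on (\<lambda>(u, v). {u<..<v}) D \<and> (\<Sum>(u, v)\<in>D. v - u) < min d d'"
    then have "(\<Sum>(u, v)\<in>D. \<bar>f v - f u\<bar>) < e / 2" "(\<Sum>(u, v)\<in>D. \<bar>g v - g u\<bar>) < e / 2"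
      using d(2) d'(2) by auto
    moreover have "(\<Sum>(u, v)\<in>D. \<bar>f v + g v - (f u + g u)\<bar>)
        \<le> (\<Sum>(u, v)\<in>D. \<bar>f v - f u\<bar>) + (\<Sum>(u, v)\<in>D. \<bar>g v - g u\<bar>)"
      unfolding sum.distrib[symmetric] by (intro sum_mono) auto
    ultimately show "(\<Sum>(u, v)\<in>D. \<bar>f v + g v - (f u + g u)\<bar>) < e"
      by linarith
  qed (use d(1) d'(1) in simp)
qed

lemma absolutely_continuous_on_if_Lipschitz:
  assumes L: "\<And>u v. \<bar>f v - f u\<bar> \<le> L * \<bar>v - u\<bar>"
  shows "absolutely_continuous_on a b f"
  unfolding absolutely_continuous_on_def
proof (intro allI impI)
  fix e :: real
  assume "0 < e"
  show "\<exists>\<delta>>0. \<forall>D. finite D \<and> (\<forall>(u, v)\<in>D. a \<le> u \<and> u < v \<and> v \<le> b) \<and>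
      disjoint_family_on (\<lambda>(u, v). {u<..<v}) D \<and> (\<Sum>(u, v)\<in>D. v - u) < \<delta> \<longrightarrow>
      (\<Sum>(u, v)\<in>D. \<bar>f v - f u\<bar>) < e"
  \<comment> \<open>The divisor \<open>\<bar>L\<bar> + 1\<close> dominates \<open>L\<close> and is
    positive whatever the sign of \<open>L\<close>.\<close>
  proof (intro exI[of _ "e / (\<bar>L\<bar> + 1)"] conjI allI impI)
    show "0 < e / (\<bar>L\<bar> + 1)"
      using \<open>0 < e\<close> by (simp add: add_nonneg_pos)
    fix D :: "(real \<times> real) set"
    assume D: "finite D \<and> (\<forall>(u, v)\<in>D. a \<le> u \<and> u < v \<and> v \<le> b) \<and>
      disjoint_family_on (\<lambda>(u, v). {u<..<v}) D \<and> (\<Sum>(u, v)\<in>D. v - u) < e / (\<bar>L\<bar> + 1)"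
    have "(\<Sum>(u, v)\<in>D. \<bar>f v - f u\<bar>) \<le> (\<Sum>(u, v)\<in>D. (\<bar>L\<bar> + 1) * (v - u))"
    proof (rule sum_mono, clarify)
      fix u v
      assume "(u, v) \<in> D"
      with D have "u < v" by auto
      have "\<bar>f v - f u\<bar> \<le> L * (v - u)"
        using L[of v u] \<open>u < v\<close> by simp
      also have "\<dots> \<le> (\<bar>L\<bar> + 1) * (v - u)"
        using \<open>u < v\<close> by (intro mult_right_mono) auto
      finally show "\<bar>f v - f u\<bar> \<le> (\<bar>L\<bar> + 1) * (v - u)" .
    qed
    also have "\<dots> = (\<bar>L\<bar> + 1) * (\<Sum>(u, v)\<in>D. v - u)"
      by (simp add: sum_distrib_left case_prod_unfold)
    also have "\<dots> < e"
      using D by (simp add: field_simps add_nonneg_pos)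
    finally show "(\<Sum>(u, v)\<in>D. \<bar>f v - f u\<bar>) < e" .
  qed
qed

section \<open>Measurability and square integrability on a compact interval\<close>

lemma borel_measurable_lebesgue_on_AE:
  fixes f g :: "real \<Rightarrow> real"
  assumes f: "f \<in> borel_measurable (lebesgue_on S)" and S: "S \<in> sets lebesgue"
    and eq: "AE x in lebesgue_on S. f x = g x"
  shows "g \<in> borel_measurable (lebesgue_on S)"
proof -
  have "(\<lambda>x. if x \<in> S then f x else 0) \<in> borel_measurable lebesgue"
    using f S by (simp add: borel_measurable_if)
  moreover have "AE x in lebesgue. (if x \<in> S then f x else 0) = (if x \<in> S then g x else 0)"
    using eq S by (simp add: AE_restrict_space_iff) 
  \<comment> \<open>Completeness of Lebesgue measure keeps measurability under a change on a null
    set.\<close>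
  ultimately have "(\<lambda>x. if x \<in> S then g x else 0) \<in> borel_measurable lebesgue"
    by (rule borel_measurable_AE)
  then show ?thesis
    using S by (simp add: borel_measurable_if)
qed

lemma integrable_mult_if_square_integrable:
  fixes f g :: "'a \<Rightarrow> real"
  assumes [measurable]: "f \<in> borel_measurable M" "g \<in> borel_measurable M"
    and "integrable M (\<lambda>x. (f x)\<^sup>2)" "integrable M (\<lambda>x. (g x)\<^sup>2)"
  shows "integrable M (\<lambda>x. f x * g x)"
proof (rule Bochner_Integration.integrable_bound)
  show "integrable M (\<lambda>x. (f x)\<^sup>2 + (g x)\<^sup>2)"
    using assms by simp
  show "AE x in M. norm (f x * g x) \<le> norm ((f x)\<^sup>2 + (g x)\<^sup>2)"
    using abs_mult_le_sum_squares[of "f x" "g x" for x] by simp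
qed measurable

lemma square_integrable_on_add:
  assumes "square_integrable_on a b f" "square_integrable_on a b g"
  shows "square_integrable_on a b (\<lambda>t. f t + g t)"
  using assms integrable_mult_if_square_integrable[of f "lebesgue_on {a..b}" g]
  by (auto simp: square_integrable_on_def power2_sum mult.assoc)

lemma square_integrable_on_cong_AE:
  assumes f: "square_integrable_on a b f" and eq: "AE x in lebesgue_on {a..b}. f x = g x"
  shows "square_integrable_on a b g"
proof -
  have [measurable]: "f \<in> borel_measurable (lebesgue_on {a..b})"
    using f by (simp add: square_integrable_on_def)
  then have [measurable]: "g \<in> borel_measurable (lebesgue_on {a..b})"
    by (rule borel_measurable_lebesgue_on_AE[OF _ _ eq]) simp
  have "integrable (lebesgue_on {a..b}) (\<lambda>x. (f x)\<^sup>2) \<longleftrightarrow> integrable (lebesgue_on {a..b}) (\<lambda>x. (g x)\<^sup>2)"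
    using eq by (intro integrable_cong_AE) auto
  then show ?thesis
    using f by (simp add: square_integrable_on_def)
qed

lemma finite_measure_lebesgue_on_Icc: "finite_measure (lebesgue_on {a..b::real})"
  by (rule finite_measureI) (simp add: emeasure_restrict_space emeasure_lborel_Icc_eq)

lemma set_integrable_if_square_integrable_on:
  assumes "square_integrable_on a b f"
  shows "set_integrable lebesgue {a..b} f"
  using finite_measure.square_integrable_imp_integrable[OF finite_measure_lebesgue_on_Icc, of f a b] assms
  by (simp add: square_integrable_on_def set_integrable_def integrable_restrict_space)

section \<open>Almost everywhere derivatives of summands and of their perturbations\<close>

lemma suitable_summand_set_integrable:
  "suitable_summand T f \<Longrightarrow> set_integrable lebesgue {0..T} (deriv f)"
  by (simp add: suitable_summand_def set_integrable_if_square_integrable_on)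

text \<open>A value of \<open>deriv\<close> does not by itself certify differentiability. Here it
  does almost everywhere, because \<open>f\<close> is the indefinite integral of
  \<open>deriv f\<close> on the interval. The sum rule for a perturbed summand rests on
  this.\<close>

lemma AE_DERIV_deriv:
  assumes f: "suitable_summand T f"
  shows "AE t in lebesgue_on {0..T}. DERIV f t :> deriv f t"
proof -
  have "AE x in lebesgue. x \<noteq> 0 \<and> x \<noteq> T"
    using AE_not_in[of "{0, T}" lebesgue] by (simp add: null_sets_completionI finite_imp_null_set_lborel)
  moreover have "AE x in lebesgue. x \<in> {0..T} \<longrightarrow>
      ((\<lambda>t. LINT s:{0..t}|lebesgue. deriv f s) has_real_derivative deriv f x) (at x)"
    using AE_has_real_derivative_indefinite_integral[OF suitable_summand_set_integrable[OF f]]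
    by (simp add: AE_restrict_space_iff)
  ultimately have "AE x in lebesgue. x \<in> {0..T} \<longrightarrow> DERIV f x :> deriv f x"
  proof (eventually_elim, intro impI)
    fix x
    assume "x \<noteq> 0 \<and> x \<noteq> T" and "x \<in> {0..T}" and
      "x \<in> {0..T} \<longrightarrow> ((\<lambda>t. LINT s:{0..t}|lebesgue. deriv f s) has_real_derivative deriv f x) (at x)"
    then have x: "0 < x" "x < T"
      and D: "((\<lambda>t. LINT s:{0..t}|lebesgue. deriv f s) has_real_derivative deriv f x) (at x)" by auto
    have "\<forall>\<^sub>F t in nhds x. t \<in> {0<..<T}"
      using x by (intro eventually_nhds_in_open) auto
    then have "\<forall>\<^sub>F t in nhds x. (LINT s:{0..t}|lebesgue. deriv f s) = f t"
      by eventually_elim (use f in \<open>simp add: suitable_summand_def\<close>)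
    with D show "DERIV f x :> deriv f x"
      by (subst (asm) DERIV_cong_ev[OF refl _ refl]) auto
  qed
  then show ?thesis
    by (subst AE_restrict_space_iff) auto
qed

text \<open>Away from the kink at \<open>a\<close>, the function \<open>min t a\<close> is locally
  the identity or constant, with slope 1 or 0. On \<open>{0..T}\<close> this slope is the indicator
  of \<open>{0..a}\<close>.\<close>

lemma AE_deriv_add_min:
  assumes f: "suitable_summand T f"
  shows "AE t in lebesgue_on {0..T}. deriv (\<lambda>t. f t + e * min t a) t = deriv f t + e * indicator {0..a} t"
proof -
  have "AE x in lebesgue. x \<noteq> a"
    using AE_not_in[of "{a}" lebesgue] by (simp add: null_sets_completionI finite_imp_null_set_lborel)
  moreover have "AE x in lebesgue. x \<in> {0..T} \<longrightarrow> DERIV f x :> deriv f x"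
    using AE_DERIV_deriv[OF f] by (simp add: AE_restrict_space_iff)
  ultimately have "AE t in lebesgue. t \<in> {0..T} \<longrightarrow>
      deriv (\<lambda>t. f t + e * min t a) t = deriv f t + e * indicator {0..a} t"
  proof (eventually_elim, intro impI)
    fix x
    assume "x \<noteq> a" and x: "x \<in> {0..T}" and D: "x \<in> {0..T} \<longrightarrow> DERIV f x :> deriv f x"
    have "((\<lambda>t. min t a) has_real_derivative indicator {0..a} x) (at x)"
    proof (cases "x < a")
      case True
      then have "\<forall>\<^sub>F t in nhds x. t \<in> {..<a}"
        by (intro eventually_nhds_in_open) auto
      then have "\<forall>\<^sub>F t in nhds x. min t a = t"
        by eventually_elim auto
      then show ?thesis
        using True x by (subst DERIV_cong_ev[OF refl _ refl]) auto
    next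
      case False
      with \<open>x \<noteq> a\<close> have "\<forall>\<^sub>F t in nhds x. t \<in> {a<..}"
        by (intro eventually_nhds_in_open) auto
      then have "\<forall>\<^sub>F t in nhds x. min t a = a"
        by eventually_elim auto
      then show ?thesis
        using False \<open>x \<noteq> a\<close> by (subst DERIV_cong_ev[OF refl _ refl]) auto
    qed
    then show "deriv (\<lambda>t. f t + e * min t a) x = deriv f x + e * indicator {0..a} x"
      using D x by (intro DERIV_imp_deriv DERIV_add DERIV_cmult) auto
  qed
  then show ?thesis
    by (subst AE_restrict_space_iff) auto
qed

lemma square_integrable_on_indicator: "square_integrable_on a b (\<lambda>t. c * indicator {u..v} t)"
proof -
  interpret finite_measure "lebesgue_on {a..b}"
    by (rule finite_measure_lebesgue_on_Icc)
  have [measurable]: "(\<lambda>t. c * indicator {u..v} t) \<in> borel_measurable (lebesgue_on {a..b})"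
    by (intro measurable_restrict_space1 measurable_completion) auto
  have "integrable (lebesgue_on {a..b}) (\<lambda>t. (c * indicator {u..v} t)\<^sup>2)"
  proof (rule integrable_const_bound)
    show "AE t in lebesgue_on {a..b}. norm ((c * indicator {u..v} t)\<^sup>2) \<le> c\<^sup>2"
      by (auto simp: indicator_def)
  qed measurable
  then show ?thesis
    by (simp add: square_integrable_on_def)
qed

text \<open>The perturbation \<open>e * min t a\<close> is Lipschitz, vanishes at 0 because
  \<open>0 \<le> a\<close>, and is on \<open>{0..T}\<close> the integral of \<open>e\<close> times
  the indicator of \<open>{0..a}\<close>.\<close>

lemma suitable_summand_add_min:
  assumes f: "suitable_summand T f" and a: "0 \<le> a"
  shows "suitable_summand T (\<lambda>t. f t + e * min t a)"
  unfolding suitable_summand_def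
proof (intro conjI ballI)
  have "\<bar>e * min v a - e * min u a\<bar> \<le> \<bar>e\<bar> * \<bar>v - u\<bar>" for u v
    unfolding right_diff_distrib[symmetric] abs_mult by (intro mult_left_mono) auto
  then have "absolutely_continuous_on 0 T (\<lambda>t. e * min t a)"
    by (rule absolutely_continuous_on_if_Lipschitz)
  then show "absolutely_continuous_on 0 T (\<lambda>t. f t + e * min t a)"
    using f by (intro absolutely_continuous_on_add) (auto simp: suitable_summand_def)
  have sq: "square_integrable_on 0 T (\<lambda>t. deriv f t + e * indicator {0..a} t)"
    using f by (intro square_integrable_on_add square_integrable_on_indicator) (simp add: suitable_summand_def)
  then show sq': "square_integrable_on 0 T (deriv (\<lambda>t. f t + e * min t a))"
  proof (rule square_integrable_on_cong_AE)
    show "AE t in lebesgue_on {0..T}.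
        deriv f t + e * indicator {0..a} t = deriv (\<lambda>t. f t + e * min t a) t"
      using AE_deriv_add_min[OF f] by eventually_elim (rule sym)
  qed
  fix t
  assume t: "t \<in> {0..T}"
  have "AE s in lebesgue. s \<in> {0..T} \<longrightarrow>
      deriv (\<lambda>t. f t + e * min t a) s = deriv f s + e * indicator {0..a} s"
    using AE_deriv_add_min[OF f] by (simp add: AE_restrict_space_iff)
  then have ae: "AE s in lebesgue. s \<in> {0..t} \<longrightarrow>
      deriv (\<lambda>t. f t + e * min t a) s = deriv f s + e * indicator {0..a} s"
    by eventually_elim (use t in auto)
  have int: "set_integrable lebesgue {0..t} (deriv (\<lambda>t. f t + e * min t a))"
    "set_integrable lebesgue {0..t} (\<lambda>t. deriv f t + e * indicator {0..a} t)"
    "set_integrable lebesgue {0..t} (deriv f)" "set_integrable lebesgue {0..t} (\<lambda>t. e * indicator {0..a} t)"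
    using t set_integrable_if_square_integrable_on[OF sq'] set_integrable_if_square_integrable_on[OF sq]
      set_integrable_if_square_integrable_on[OF square_integrable_on_indicator, of 0 T e 0 a]
      suitable_summand_set_integrable[OF f]
    by (auto elim!: set_integrable_subset)
  have "(LINT s:{0..t}|lebesgue. deriv (\<lambda>t. f t + e * min t a) s)
      = (LINT s:{0..t}|lebesgue. deriv f s + e * indicator {0..a} s)"
    using int(1,2) ae unfolding set_lebesgue_integral_def set_integrable_def
    by (intro integral_cong_AE) (auto simp: indicator_def)
  also have "\<dots> = (LINT s:{0..t}|lebesgue. deriv f s) + (LINT s:{0..t}|lebesgue. e * indicator {0..a} s)"
    using int by (intro set_integral_add)
  also have "(LINT s:{0..t}|lebesgue. deriv f s) = f t"
    using f t by (simp add: suitable_summand_def)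
  also have "(LINT s:{0..t}|lebesgue. e * indicator {0..a} s) = (LINT s|lebesgue. e * indicator {0..min t a} s)"
    unfolding set_lebesgue_integral_def by (intro Bochner_Integration.integral_cong) (auto simp: indicator_def)
  also have "\<dots> = e * min t a"
    using a t by simp
  finally show "f t + e * min t a = (LINT s:{0..t}|lebesgue. deriv (\<lambda>t. f t + e * min t a) s)"
    by simp
qed

section \<open>The fractional kernel\<close>

text \<open>The indicator extends the kernel by zero, so that the fixed range \<open>{0..T}\<close>
  serves for integration in either variable. On the diagonal, where the kernel is singular, the
  convention \<open>0 powr x = 0\<close> gives it the value 0.\<close>

definition RL_kernel :: "real \<Rightarrow> real \<Rightarrow> real \<Rightarrow> real" where
  "RL_kernel \<alpha> t z = indicator {0..t} z * (t powr - \<alpha> * (t - z) powr (\<alpha> - 1) * z powr \<alpha>)"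

lemma RL_kernel_nonneg: "0 \<le> RL_kernel \<alpha> t z"
  by (simp add: RL_kernel_def)

lemma RL_kernel_eq_0: "z \<notin> {0..t} \<Longrightarrow> RL_kernel \<alpha> t z = 0"
  by (simp add: RL_kernel_def)

lemma RL_kernel_le:
  assumes "0 < \<alpha>" and z: "z \<in> {0..t}"
  shows "RL_kernel \<alpha> t z \<le> (t - z) powr (\<alpha> - 1)"
proof -
  have "t powr - \<alpha> * z powr \<alpha> \<le> t powr - \<alpha> * t powr \<alpha>"
    using assms by (intro mult_left_mono powr_mono2) auto
  \<comment> \<open>The product is 1 for \<open>t \<noteq> 0\<close> but 0 for \<open>t = 0\<close>,
    hence an inequality.\<close>
  also have "\<dots> \<le> 1"
    by (simp flip: powr_add)
  finally have "t powr - \<alpha> * z powr \<alpha> * (t - z) powr (\<alpha> - 1) \<le> 1 * (t - z) powr (\<alpha> - 1)"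
    by (intro mult_right_mono) auto
  with z show ?thesis
    by (simp add: RL_kernel_def mult_ac)
qed

text \<open>The dominating power is integrable because its exponent \<open>\<alpha> - 1\<close>
  exceeds -1; the substitution \<open>x = t - z\<close> reduces its integral to that of
  \<open>x powr (\<alpha> - 1)\<close> over \<open>{0..t}\<close>.\<close>

lemma RL_kernel_row:
  assumes "0 < \<alpha>" and t: "t \<in> {0..T}"
  shows "(\<integral>\<^sup>+ z. ennreal (RL_kernel \<alpha> t z) \<partial>lebesgue_on {0..T}) \<le> ennreal (T powr \<alpha> / \<alpha>)"
proof -
  have "((\<lambda>x. x powr (\<alpha> - 1)) has_integral t powr \<alpha> / \<alpha>) (cbox 0 t)"
    using has_integral_powr_from_0[of "\<alpha> - 1" t] assms by simp
  from has_integral_affinity[OF this, of "-1" t]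
  have I: "((\<lambda>z. (t - z) powr (\<alpha> - 1)) has_integral t powr \<alpha> / \<alpha>) {0..t}"
    using t by (simp add: image_minus_const_atLeastAtMost' )
  have "(\<integral>\<^sup>+ z. ennreal (RL_kernel \<alpha> t z) \<partial>lebesgue_on {0..T})
      = (\<integral>\<^sup>+ z. ennreal (RL_kernel \<alpha> t z) * indicator {0..T} z \<partial>lborel)"
    by (subst nn_integral_restrict_space) (auto simp: nn_integral_completion)
  also have "\<dots> \<le> (\<integral>\<^sup>+ z. ennreal ((t - z) powr (\<alpha> - 1)) * indicator {0..t} z \<partial>lborel)"
  proof (rule nn_integral_mono)
    fix z
    show "ennreal (RL_kernel \<alpha> t z) * indicator {0..T} z \<le> ennreal ((t - z) powr (\<alpha> - 1)) * indicator {0..t} z"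
      using RL_kernel_le[OF assms(1), of z t] RL_kernel_eq_0[of z t \<alpha>] t
      by (cases "z \<in> {0..t}") (auto intro!: ennreal_leI)
  qed
  also have "\<dots> = ennreal (t powr \<alpha> / \<alpha>)"
    by (rule nn_integral_has_integral_lebesgue'[OF _ I]) simp
  also have "\<dots> \<le> ennreal (T powr \<alpha> / \<alpha>)"
    using assms by (intro ennreal_leI divide_right_mono powr_mono2) auto
  finally show ?thesis .
qed

text \<open>The dominating power depends on \<open>t - z\<close> only, so a translation gives the
  same constant as for the rows.\<close>

lemma RL_kernel_col:
  assumes "0 < \<alpha>" and z: "z \<in> {0..T}"
  shows "(\<integral>\<^sup>+ t. ennreal (RL_kernel \<alpha> t z) \<partial>lebesgue_on {0..T}) \<le> ennreal (T powr \<alpha> / \<alpha>)"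
proof -
  have "((\<lambda>x. x powr (\<alpha> - 1)) has_integral (T - z) powr \<alpha> / \<alpha>) (cbox 0 (T - z))"
    using has_integral_powr_from_0[of "\<alpha> - 1" "T - z"] assms by simp
  from has_integral_affinity[OF this, of 1 "- z"]
  have I: "((\<lambda>t. (t - z) powr (\<alpha> - 1)) has_integral (T - z) powr \<alpha> / \<alpha>) {z..T}"
    using z by simp
  have "(\<integral>\<^sup>+ t. ennreal (RL_kernel \<alpha> t z) \<partial>lebesgue_on {0..T})
      = (\<integral>\<^sup>+ t. ennreal (RL_kernel \<alpha> t z) * indicator {0..T} t \<partial>lborel)"
    by (subst nn_integral_restrict_space) (auto simp: nn_integral_completion)
  also have "\<dots> \<le> (\<integral>\<^sup>+ t. ennreal ((t - z) powr (\<alpha> - 1)) * indicator {z..T} t \<partial>lborel)"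
  proof (rule nn_integral_mono)
    fix t
    show "ennreal (RL_kernel \<alpha> t z) * indicator {0..T} t \<le> ennreal ((t - z) powr (\<alpha> - 1)) * indicator {z..T} t"
      using RL_kernel_le[OF assms(1), of z t] RL_kernel_eq_0[of z t \<alpha>] z
      by (cases "z \<in> {0..t}") (auto simp: indicator_def intro!: ennreal_leI)
  qed
  also have "\<dots> = ennreal ((T - z) powr \<alpha> / \<alpha>)"
    by (rule nn_integral_has_integral_lebesgue'[OF _ I]) simp
  also have "\<dots> \<le> ennreal (T powr \<alpha> / \<alpha>)"
    using assms by (intro ennreal_leI divide_right_mono powr_mono2) auto
  finally show ?thesis .
qed

lemma borel_measurable_RL_kernel:
  "case_prod (RL_kernel \<alpha>) \<in> borel_measurable (lebesgue_on {0..T} \<Otimes>\<^sub>M lebesgue_on {0..T})"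
proof -
  have [measurable]: "(\<lambda>x. x) \<in> borel_measurable (lebesgue_on {0..T})"
    by (intro measurable_restrict_space1 measurable_completion) auto
  have [measurable]: "fst \<in> borel_measurable (lebesgue_on {0..T} \<Otimes>\<^sub>M lebesgue_on {0..T})"
    by (rule measurable_compose[OF measurable_fst]) measurable
  have [measurable]: "snd \<in> borel_measurable (lebesgue_on {0..T} \<Otimes>\<^sub>M lebesgue_on {0..T})"
    by (rule measurable_compose[OF measurable_snd]) measurable
  \<comment> \<open>With the indicator written as a conditional, measurability reduces to that of
    the two coordinates.\<close>
  have "(\<lambda>p. (if 0 \<le> snd p \<and> snd p \<le> fst p then 1 else 0) *
      (fst p powr - \<alpha> * (fst p - snd p) powr (\<alpha> - 1) * snd p powr \<alpha>))
    \<in> borel_measurable (lebesgue_on {0..T} \<Otimes>\<^sub>M lebesgue_on {0..T})"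
    by measurable
  moreover have "case_prod (RL_kernel \<alpha>) = (\<lambda>p. (if 0 \<le> snd p \<and> snd p \<le> fst p then 1 else 0) *
      (fst p powr - \<alpha> * (fst p - snd p) powr (\<alpha> - 1) * snd p powr \<alpha>))"
    by (auto simp: RL_kernel_def fun_eq_iff)
  ultimately show ?thesis
    by simp
qed

lemma schur_kernel_RL_kernel:
  assumes "0 < \<alpha>"
  shows "schur_kernel (lebesgue_on {0..T}) (RL_kernel \<alpha>) (T powr \<alpha> / \<alpha>)"
  by (intro schur_kernel.intro schur_kernel_axioms.intro finite_measure_lebesgue_on_Icc
      borel_measurable_RL_kernel RL_kernel_nonneg RL_kernel_row RL_kernel_col)
    (use assms in auto)

section \<open>The fractional operators expressed through the kernel\<close>

lemma Icc_Int_space_lebesgue: "{a..b::real} \<inter> space lebesgue \<in> sets lebesgue"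
  by simp

lemma K_star_eq:
  assumes t: "t \<in> {0..T}"
  shows "K_star H \<phi> t = inverse (C1 H) / Gamma (1/2 - H) *
    (\<integral>z. RL_kernel (1/2 - H) t z * \<phi> z \<partial>lebesgue_on {0..T})"
proof -
  have "(\<integral>z. RL_kernel (1/2 - H) t z * \<phi> z \<partial>lebesgue_on {0..T})
      = (\<integral>z. t powr (H - 1/2) * (indicator {0..t} z *\<^sub>R ((t - z) powr (1/2 - H - 1) * (z powr (1/2 - H) * \<phi> z))) \<partial>lebesgue)"
    unfolding integral_restrict_space[OF Icc_Int_space_lebesgue]
    by (rule Bochner_Integration.integral_cong) (use t in \<open>auto simp: RL_kernel_def indicator_def\<close>)
  then show ?thesis
    by (simp add: K_star_def RL_left_def set_lebesgue_integral_def)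
qed

text \<open>This identifies the nested operator as the adjoint of \<open>K_star\<close> applied to
  \<open>K_star H \<phi>\<close>. The weight \<open>s powr (2 * H - 1)\<close> is a product of two
  equal powers: one belongs to the inner \<open>K_star\<close>, the other to the transposed kernel.
  The constants split in the same way.\<close>

lemma RL_right_RL_left_eq:
  assumes t: "t \<in> {0..T}"
  shows "inverse ((C1 H)\<^sup>2) * t powr (1/2 - H) *
      RL_right T (1/2 - H)
        (\<lambda>s. s powr (2 * H - 1) *
          RL_left (1/2 - H) (\<lambda>z. z powr (1/2 - H) * \<phi> z) s) t
    = inverse (C1 H) / Gamma (1/2 - H) *
      (\<integral>s. RL_kernel (1/2 - H) s t * K_star H \<phi> s \<partial>lebesgue_on {0..T})"
proof -
  define L where "L = RL_left (1/2 - H) (\<lambda>z. z powr (1/2 - H) * \<phi> z)"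
  have "s powr (2 * H - 1) = s powr (H - 1/2) * s powr (H - 1/2)" for s :: real
    by (simp flip: powr_add)
  then have "(\<integral>s. RL_kernel (1/2 - H) s t * K_star H \<phi> s \<partial>lebesgue_on {0..T})
      = (\<integral>s. (inverse (C1 H) * t powr (1/2 - H)) *
          (indicator {t..T} s *\<^sub>R ((s - t) powr (1/2 - H - 1) * (s powr (2 * H - 1) * L s))) \<partial>lebesgue)"
    unfolding integral_restrict_space[OF Icc_Int_space_lebesgue]
    by (intro Bochner_Integration.integral_cong) (use t in \<open>auto simp: RL_kernel_def indicator_def K_star_def L_def\<close>)
  then show ?thesis
    by (simp add: RL_right_def set_lebesgue_integral_def L_def power2_eq_square)
qed

section \<open>First variation of the cost\<close>

lemma linear_coeff_zero_if_quadratic_nonneg: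
  fixes L Q :: real
  assumes "\<And>e. 0 \<le> 2 * e * L + e\<^sup>2 * Q"
  shows "L = 0"
proof (rule ccontr)
  assume "L \<noteq> 0"
  \<comment> \<open>A positive upper bound of \<open>Q\<close> whatever its sign;
    \<open>- L / q\<close> then minimizes the quadratic with \<open>Q\<close> replaced by
    \<open>q\<close>, with value \<open>- (L\<^sup>2 / q)\<close>.\<close>
  define q where "q = \<bar>Q\<bar> + 1"
  have q: "0 < q" "Q \<le> q"
    by (auto simp: q_def)
  have "0 \<le> 2 * (- L / q) * L + (- L / q)\<^sup>2 * Q"
    by (rule assms)
  also have "\<dots> \<le> 2 * (- L / q) * L + (- L / q)\<^sup>2 * q"
    using q by (intro add_left_mono mult_left_mono) auto
  also have "\<dots> = - (L\<^sup>2 / q)"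
    using q by (simp add: field_simps power2_eq_square)
  also have "\<dots> < 0"
    using q \<open>L \<noteq> 0\<close> by simp
  finally show False by simp
qed

text \<open>The two perturbations are opposite, so the sum of the summands is unchanged.\<close>

lemma suitable_expansion_shift:
  assumes "suitable_expansion T g g_W g_B" "0 \<le> a"
  shows "suitable_expansion T g (\<lambda>t. g_W t + - e * min t a) (\<lambda>t. g_B t + e * min t a)"
  using assms suitable_summand_add_min[of T g_W a "- e"] suitable_summand_add_min[of T g_B a e]
  by (simp add: suitable_expansion_def)

text \<open>All three functions are integrals of their derivatives, so the difference of the two
  sides has indefinite integral \<open>g t - (g_W t + g_B t)\<close>, which is zero.\<close>

lemma AE_deriv_suitable_expansion:
  assumes int: "\<forall>t\<in>{0..T}. g t = (LINT s:{0..t}|lebesgue. deriv g s)"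
    and sq: "square_integrable_on 0 T (deriv g)"
    and suit: "suitable_expansion T g g_W g_B"
  shows "AE t in lebesgue_on {0..T}. deriv g t = deriv g_W t + deriv g_B t"
proof -
  have W: "suitable_summand T g_W" and B: "suitable_summand T g_B"
    using suit by (auto simp: suitable_expansion_def)
  note set_int = set_integrable_if_square_integrable_on[OF sq]
    suitable_summand_set_integrable[OF W] suitable_summand_set_integrable[OF B]
  have "AE t in lebesgue_on {0..T}. deriv g t - (deriv g_W t + deriv g_B t) = 0"
  proof (rule AE_zero_if_indefinite_integral_zero)
    show "set_integrable lebesgue {0..T} (\<lambda>t. deriv g t - (deriv g_W t + deriv g_B t))"
      using set_int by (intro set_integral_diff set_integral_add)
    fix t
    assume t: "t \<in> {0..T}"
    then have "set_integrable lebesgue {0..t} (deriv g)" "set_integrable lebesgue {0..t} (deriv g_W)"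
      "set_integrable lebesgue {0..t} (deriv g_B)"
      using set_int by (auto elim!: set_integrable_subset)
    then have "(LINT s:{0..t}|lebesgue. deriv g s - (deriv g_W s + deriv g_B s))
        = (LINT s:{0..t}|lebesgue. deriv g s)
          - ((LINT s:{0..t}|lebesgue. deriv g_W s) + (LINT s:{0..t}|lebesgue. deriv g_B s))"
      by (simp add: set_integral_diff set_integral_add)
    also have "\<dots> = g t - (g_W t + g_B t)"
      using t int W B by (simp add: suitable_summand_def)
    also have "\<dots> = 0"
      using t suit by (simp add: suitable_expansion_def)
    finally show "(LINT s:{0..t}|lebesgue. deriv g s - (deriv g_W s + deriv g_B s)) = 0" .
  qed
  then show ?thesis
    by eventually_elim simp
qed

theorem lemma3p4:
  fixes H T :: real and g g_W g_B :: "real \<Rightarrow> real"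
  assumes "0 < H" "H < 1/2" "0 < T"
    and "absolutely_continuous_on 0 T g"
    and "\<forall>t\<in>{0..T}. g t = (LINT s:{0..t}|lebesgue. deriv g s)"
    and "square_integrable_on 0 T (deriv g)"
    and "is_arg_min (\<lambda>(w, b). expansion_cost H T w b)
           (\<lambda>(w, b). suitable_expansion T g w b) (g_W, g_B)"
  shows "AE t in lebesgue_on {0..T}.
    inverse ((C1 H)\<^sup>2) * t powr (1/2 - H) *
      RL_right T (1/2 - H)
        (\<lambda>s. s powr (2 * H - 1) *
          RL_left (1/2 - H) (\<lambda>z. z powr (1/2 - H) * deriv g_B z) s) t
    + deriv g_B t = deriv g t"
proof -
  define M where "M = lebesgue_on {0..T}"
  define c where "c = inverse (C1 H) / Gamma (1/2 - H)"
  define w where "w = deriv g_W"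
  define b where "b = deriv g_B"
  have space_M [simp]: "space M = {0..T}"
    by (simp add: M_def)
  have "0 < 1/2 - H"
    using assms(2) by simp
  then interpret schur_kernel M "RL_kernel (1/2 - H)" "T powr (1/2 - H) / (1/2 - H)"
    unfolding M_def by (rule schur_kernel_RL_kernel)
  have K: "K_star H \<phi> t = c * kernel_op \<phi> t" if "t \<in> {0..T}" for \<phi> t
    unfolding kernel_op_def unfolding c_def M_def using that by (rule K_star_eq)

  have suit: "suitable_expansion T g g_W g_B"
    and min: "\<And>x y. suitable_expansion T g x y \<Longrightarrow> expansion_cost H T g_W g_B \<le> expansion_cost H T x y"
    using assms(7) by (auto simp: is_arg_min_linorder)
  then have W: "suitable_summand T g_W" and B: "suitable_summand T g_B"
    by (auto simp: suitable_expansion_def)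
  have [measurable]: "w \<in> borel_measurable M" "b \<in> borel_measurable M"
    and w2: "integrable M (\<lambda>t. (w t)\<^sup>2)" and b2: "integrable M (\<lambda>t. (b t)\<^sup>2)"
    using W B by (auto simp: suitable_summand_def square_integrable_on_def w_def b_def M_def)
  have cost: "expansion_cost H T x y = (\<integral>t. (deriv x t)\<^sup>2 + (c * kernel_op (deriv y) t)\<^sup>2 \<partial>M)" for x y
    unfolding expansion_cost_def set_lebesgue_integral_def M_def
    by (subst integral_restrict_space)
      (auto intro!: Bochner_Integration.integral_cong simp: K indicator_def simp flip: M_def)

  \<comment> \<open>On \<open>{0..T}\<close> this is the function \<open>h\<close> of the cost, that
    is \<open>K_star H (deriv g_B)\<close>.\<close>
  define u where "u = (\<lambda>t. c * kernel_op b t)"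
  have [measurable]: "u \<in> borel_measurable M"
    by (simp add: u_def)
  have u2: "integrable M (\<lambda>t. (u t)\<^sup>2)"
    using integrable_op_power2[OF _ b2] by (simp add: u_def power_mult_distrib)
  \<comment> \<open>The constant 1 is square-integrable on the finite measure \<open>M\<close>;
    pairing it with the adjoint gives integrability.\<close>
  have adj_int: "integrable M (kernel_adj u)"
    using integrable_mult_adj[of "\<lambda>_. 1" u] u2 by simp
  have w_int: "integrable M w"
    using w2 by (rule square_integrable_imp_integrable[rotated]) simp

  have first_variation: "(\<integral>t. indicator {0..a} t * (c * kernel_adj u t - w t) \<partial>M) = 0"
    if a: "a \<in> {0..T}" for a
  proof -
    define \<psi> :: "real \<Rightarrow> real" where "\<psi> = indicator {0..a}"
    have \<psi>: "square_integrable_on 0 T \<psi>"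
      using square_integrable_on_indicator[of 0 T 1 0 a] by (simp add: \<psi>_def)
    then have [measurable]: "\<psi> \<in> borel_measurable M" and \<psi>2: "integrable M (\<lambda>t. (\<psi> t)\<^sup>2)"
      by (auto simp: square_integrable_on_def M_def)
    define v where "v = (\<lambda>t. c * kernel_op \<psi> t)"
    have [measurable]: "v \<in> borel_measurable M"
      by (simp add: v_def)
    have v2: "integrable M (\<lambda>t. (v t)\<^sup>2)"
      using integrable_op_power2[OF _ \<psi>2] by (simp add: v_def power_mult_distrib)
    have products: "integrable M (\<lambda>t. w t * \<psi> t)" "integrable M (\<lambda>t. u t * v t)"
      by (auto intro!: integrable_mult_if_square_integrable w2 \<psi>2 u2 v2)
    \<comment> \<open>The cost of the perturbed expansion exceeds the minimum by
      \<open>2 * e * L + e\<^sup>2 * Q\<close>, so \<open>L\<close> is half its derivative at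
      \<open>e = 0\<close>.\<close>
    define L where "L = (\<integral>t. u t * v t \<partial>M) - (\<integral>t. w t * \<psi> t \<partial>M)"
    define Q where "Q = (\<integral>t. (\<psi> t)\<^sup>2 + (v t)\<^sup>2 \<partial>M)"
    have "0 \<le> 2 * e * L + e\<^sup>2 * Q" for e
    proof -
      define x where "x = (\<lambda>t. g_W t + - e * min t a)"
      define y where "y = (\<lambda>t. g_B t + e * min t a)"
      have xy: "suitable_expansion T g x y"
        using suitable_expansion_shift[OF suit, of a e] a by (simp add: x_def y_def)
      then have [measurable]: "deriv x \<in> borel_measurable M" "deriv y \<in> borel_measurable M"
        by (auto simp: suitable_expansion_def suitable_summand_def square_integrable_on_def M_def)
      have dx: "AE t in M. deriv x t = w t + - e * \<psi> t" and dy: "AE t in M. deriv y t = b t + e * \<psi> t"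
        unfolding x_def y_def w_def b_def \<psi>_def M_def
        by (rule AE_deriv_add_min[OF W], rule AE_deriv_add_min[OF B])
      have "AE t in M. kernel_op (\<lambda>s. b s + e * \<psi> s) t = kernel_op b t + e * kernel_op \<psi> t"
        by (intro AE_kernel_op_add_cmult b2 \<psi>2) measurable
      \<comment> \<open>The derivative of \<open>y\<close> is first replaced by
        \<open>b + e * \<psi>\<close> inside the operator, which is valid at every point of
        \<open>M\<close>; the linear splitting then holds almost everywhere.\<close>
      with AE_space[of M] have "AE t in M. c * kernel_op (deriv y) t = u t + e * v t"
      proof eventually_elim
        case (elim t)
        then have "kernel_op (deriv y) t = kernel_op b t + e * kernel_op \<psi> t"
          using kernel_op_cong_AE[OF dy, of t] by simp
        then show ?case
          by (simp add: u_def v_def algebra_simps)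
      qed
      then have "expansion_cost H T x y = (\<integral>t. (w t + - e * \<psi> t)\<^sup>2 + (u t + e * v t)\<^sup>2 \<partial>M)"
        unfolding cost using dx by (intro integral_cong_AE) auto
      also have "\<dots> = (\<integral>t. ((w t)\<^sup>2 + (u t)\<^sup>2) + (2 * e * (u t * v t - w t * \<psi> t) + e\<^sup>2 * ((\<psi> t)\<^sup>2 + (v t)\<^sup>2)) \<partial>M)"
        by (intro Bochner_Integration.integral_cong) (auto simp: power2_eq_square algebra_simps)
      also have "\<dots> = (\<integral>t. (w t)\<^sup>2 + (u t)\<^sup>2 \<partial>M) + (2 * e * L + e\<^sup>2 * Q)"
        using products w2 u2 \<psi>2 v2 by (simp add: L_def Q_def)
      also have "(\<integral>t. (w t)\<^sup>2 + (u t)\<^sup>2 \<partial>M) = expansion_cost H T g_W g_B"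
        by (simp add: cost u_def w_def b_def)
      finally show ?thesis
        using min[OF xy] by simp
    qed
    then have "L = 0"
      by (rule linear_coeff_zero_if_quadratic_nonneg)
    \<comment> \<open>Passing to the adjoint frees \<open>\<psi>\<close> from the operator, so that
      \<open>L\<close> becomes the integral of \<open>\<psi>\<close> against
      \<open>c * kernel_adj u - w\<close>.\<close>
    moreover have "(\<integral>t. u t * v t \<partial>M) = c * (\<integral>t. kernel_op \<psi> t * u t \<partial>M)"
      by (simp add: v_def mult_ac flip: integral_mult_right_zero)
    moreover have "(\<integral>t. kernel_op \<psi> t * u t \<partial>M) = (\<integral>t. \<psi> t * kernel_adj u t \<partial>M)"
      by (intro integral_op_adj \<psi>2 u2) auto
    moreover have "integrable M (\<lambda>t. \<psi> t * kernel_adj u t)"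
      by (intro integrable_mult_adj \<psi>2 u2) auto
    ultimately have "(\<integral>t. c * (\<psi> t * kernel_adj u t) - w t * \<psi> t \<partial>M) = 0"
      using products by (simp add: L_def)
    then show ?thesis
      by (simp add: \<psi>_def algebra_simps)
  qed

  \<comment> \<open>As \<open>a\<close> is arbitrary, the first variation says that every indefinite
    integral of this function vanishes.\<close>
  have "AE t in lebesgue_on {0..T}. c * kernel_adj u t - w t = 0"
  proof (rule AE_zero_if_indefinite_integral_zero)
    have "integrable M (\<lambda>t. c * kernel_adj u t - w t)"
      using adj_int w_int by simp
    then show "set_integrable lebesgue {0..T} (\<lambda>t. c * kernel_adj u t - w t)"
      unfolding M_def set_integrable_def by (subst (asm) integrable_restrict_space) auto
    fix a
    assume a: "a \<in> {0..T}"
    have "(LINT t:{0..a}|lebesgue. c * kernel_adj u t - w t)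
        = (\<integral>t. indicator {0..a} t * (c * kernel_adj u t - w t) \<partial>M)"
      unfolding M_def set_lebesgue_integral_def using a
      by (subst integral_restrict_space) (auto intro!: Bochner_Integration.integral_cong simp: indicator_def)
    with first_variation[OF a] show "(LINT t:{0..a}|lebesgue. c * kernel_adj u t - w t) = 0"
      by simp
  qed
  moreover have "AE t in lebesgue_on {0..T}. deriv g t = w t + b t"
    using AE_deriv_suitable_expansion[OF assms(5,6) suit] by (simp add: w_def b_def)
  moreover have "AE t in lebesgue_on {0..T}. t \<in> {0..T}"
    using AE_space[of "lebesgue_on {0..T}"] by simp
  ultimately show ?thesis
  proof eventually_elim
    case (elim t)
    \<comment> \<open>With the adjoint term identified, the equation is
      \<open>w = c * kernel_adj u\<close> inserted into \<open>deriv g = w + b\<close>.\<close>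
    have "(\<integral>s. RL_kernel (1/2 - H) s t * K_star H b s \<partial>M) = kernel_adj u t"
      unfolding kernel_adj_def by (intro Bochner_Integration.integral_cong) (auto simp: K u_def)
    then have "inverse ((C1 H)\<^sup>2) * t powr (1/2 - H) *
      RL_right T (1/2 - H)
        (\<lambda>s. s powr (2 * H - 1) * RL_left (1/2 - H) (\<lambda>z. z powr (1/2 - H) * b z) s) t
      = c * kernel_adj u t"
      using RL_right_RL_left_eq[OF elim(3), of H b] by (simp add: c_def M_def)
    with elim show ?case
      by (simp add: b_def)
  qed
qed

end
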